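(* Let $m,n\in\mathbb{N}$ be coprime positive integers and let $f,g:\mathbb{T}\to\mathbb{R}$ be functions on the unit circle. If there is a nonzero integer $k$ such that $$f(\omega^k)=g(\omega^m)-g(\omega^n)\qquad\text{for all }\omega\in\mathbb{T},$$ then $f$ satisfies the Cooper $(m,n)$-signature condition; that is, for all $p,c\in\mathbb{N}$ with $\gcd(m,p)=\gcd(n,p)=\gcd(c,p)=1$, $$\sum_{\ell=1}^{r} f\left(e^{2\pi i\,\frac{c\,(n\overline{m})^\ell}{p}}\right)=0,$$ where $\overline{m}\in\mathbb{N}$ is an inverse of $m$ modulo $p$ and $r$ is the order of $n\overline{m}$ in the multiplicative group of units of $\mathbb{Z}/p$.
   Context: $\mathbb{T}=\{\omega\in\mathbb{C}:|\omega|=1\}$; $\mathbb{N}$ denotes the positive integers. *)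

theory Defs
  imports "HOL-Analysis.Analysis" "HOL-Number_Theory.Number_Theory"
begin

text \<open>
  Functions on the unit circle are represented by total functions on \<^typ>\<open>complex\<close>; only their
  values on \<open>sphere 0 1\<close> are ever used. The condition is required for every positive inverse
  \<open>mbar\<close> of \<open>m\<close> modulo \<open>p\<close>; the sum does not depend on which one is chosen.
  \<open>ord p a\<close> is the order of \<open>a\<close> in the group of units modulo \<open>p\<close>; it is \<open>1\<close> for \<open>p = 1\<close>.
\<close>

definition cooper_signature :: "nat \<Rightarrow> nat \<Rightarrow> (complex \<Rightarrow> real) \<Rightarrow> bool" where
  "cooper_signature m n f \<longleftrightarrow>
     (\<forall>p c mbar. p > 0 \<and> c > 0 \<and> mbar > 0 \<and>
        gcd m p = 1 \<and> gcd n p = 1 \<and> gcd c p = 1 \<and> [m * mbar = 1] (mod p) \<longrightarrow>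
        (\<Sum>l = 1..ord p (n * mbar).
           f (exp (2 * pi * \<i> * of_nat (c * (n * mbar) ^ l) / of_nat p))) = 0)"

end

theory Submission imports Defs begin

text \<open>
  If \<open>k\<close> is coprime to \<open>p\<close>, the sum telescopes after replacing \<open>\<omega>\<close> by a \<open>p\<close>-th root of unity.
  In general write \<open>k = K * N\<close> with \<open>K\<close> coprime to \<open>p\<close> and every prime factor of \<open>N\<close> dividing \<open>p\<close>,
  and average over those \<open>k\<close>-th roots of \<open>p\<close>-th roots of unity that are \<open>p * N\<close>-th roots of unity.
  On the group of \<open>p * N\<close>-th roots of unity, the maps \<open>\<omega> \<mapsto> \<omega> ^ m\<close> and \<open>\<omega> \<mapsto> \<omega> ^ n\<close> permute the
  fibres of \<open>\<omega> \<mapsto> \<omega> ^ N\<close>, because \<open>m\<close> and \<open>n\<close> are coprime to \<open>p * N\<close>; hence the sums of \<open>g\<close> over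
  these fibres telescope.
\<close>

text \<open>As \<open>a\<close> is a unit modulo \<open>N\<close>, the affine map permutes the
  residues modulo \<open>N\<close>.\<close>

lemma sum_periodic_affine:
  fixes P :: "int \<Rightarrow> 'a :: comm_monoid_add"
  assumes "N > 0" "coprime a N" and per: "\<And>x y. [x = y] (mod N) \<Longrightarrow> P x = P y"
  shows "(\<Sum>j\<in>{0..<N}. P (a * j + b)) = (\<Sum>j\<in>{0..<N}. P j)"
proof -
  let ?h = "\<lambda>j. (a * j + b) mod N"
  have inj: "inj_on ?h {0..<N}"
  proof (rule inj_onI)
    fix x y assume x: "x \<in> {0..<N}" and y: "y \<in> {0..<N}" and "?h x = ?h y"
    then have "[a * x = a * y] (mod N)"
      by (metis cong_add_rcancel cong_def)
    then have "[x = y] (mod N)"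
      using \<open>coprime a N\<close> cong_mult_lcancel by blast
    then show "x = y"
      using x y by (simp add: cong_def)
  qed
  have "?h ` {0..<N} \<subseteq> {0..<N}"
    using \<open>N > 0\<close> by auto
  then have "bij_betw ?h {0..<N} {0..<N}"
    using inj by (simp add: bij_betw_def endo_inj_surj)
  then have "(\<Sum>j\<in>{0..<N}. P (?h j)) = (\<Sum>j\<in>{0..<N}. P j)"
    by (rule sum.reindex_bij_betw)
  moreover have "P (?h j) = P (a * j + b)" for j
    by (rule per) (simp add: cong_def)
  ultimately show ?thesis
    by simp
qed

text \<open>Strong induction on \<open>k\<close>: as long as \<open>k\<close> shares a factor with
  \<open>p\<close>, move \<open>gcd k p\<close> into \<open>N\<close>; a number coprime to
  \<open>p\<close> is coprime to each factor moved. The last property encodes that every prime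
  factor of \<open>N\<close> divides \<open>p\<close>.\<close>

lemma coprime_part_decomposition:
  fixes p :: int and k :: nat
  assumes "k > 0"
  obtains K N :: int where "int k = K * N" "N > 0" "coprime K p"
    "\<And>x. coprime x p \<Longrightarrow> coprime x N"
proof -
  have "\<exists>K N. int k = K * N \<and> N > 0 \<and> coprime K p \<and> (\<forall>x. coprime x p \<longrightarrow> coprime x N)"
    using assms
  proof (induction k rule: less_induct)
    case (less k)
    define d where "d = nat (gcd (int k) p)"
    have d: "int d = gcd (int k) p"
      by (simp add: d_def)
    show ?case
    proof (cases "coprime (int k) p")
      case True
      then show ?thesis
        using less.prems by (intro exI[of _ "int k"] exI[of _ 1]) auto
    next
      case False
      have "d dvd k"
        by (metis d gcd_dvd1 int_dvd_int_iff)
      then obtain j where k: "k = d * j"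
        by (auto elim: dvdE)
      have "d > 0"
        using k less.prems by (cases d) auto
      moreover have "d \<noteq> 1"
        using False d by (auto simp: coprime_iff_gcd_eq_1)
      ultimately have "d > 1"
        by simp
      then have "j < k" "j > 0"
        using k less.prems by auto
      with less.IH obtain K N where KN: "int j = K * N" "N > 0" "coprime K p"
        "\<forall>x. coprime x p \<longrightarrow> coprime x N"
        by blast
      have "coprime x (int d * N)" if "coprime x p" for x
      proof -
        have "coprime x (int d)"
          using that by (rule coprime_divisors[rotated 2]) (simp_all add: d)
        then show ?thesis
          using that KN(4) by simp
      qed
      moreover have "int k = K * (int d * N)"
        by (simp add: k KN(1))
      ultimately show ?thesis
        using KN \<open>d > 0\<close> by (intro exI[of _ K] exI[of _ "int d * N"]) auto
    qed
  qed
  then show thesis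
    using that by blast
qed

lemma cis_frac_cong:
  assumes "q \<noteq> 0" "[x = y] (mod q)"
  shows "cis (2 * pi * (of_int x / of_int q)) = cis (2 * pi * (of_int y / of_int q))"
proof -
  obtain j where j: "x = y + q * j"
    using assms(2) by (metis cong_iff_lin cong_sym)
  have "2 * pi * (of_int x / of_int q) = 2 * pi * (of_int y / of_int q) + 2 * pi * of_int j"
    using assms(1) by (simp add: j field_simps)
  then show ?thesis
    by (simp add: cis_mult[symmetric] cis_multiple_2pi)
qed

theorem proposition4p8:
  fixes m n :: nat and k :: int and f g :: "complex \<Rightarrow> real"
  assumes "m > 0" and "n > 0" and "coprime m n"
    and "k \<noteq> 0"
    and "\<And>\<omega>. \<omega> \<in> sphere 0 1 \<Longrightarrow> f (\<omega> powi k) = g (\<omega> ^ m) - g (\<omega> ^ n)"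
  shows "cooper_signature m n f"
  unfolding cooper_signature_def
proof (intro allI impI, elim conjE)
  fix p c mbar :: nat
  assume "p > 0" and cop: "gcd m p = 1" "gcd n p = 1"
    and mbar: "[m * mbar = 1] (mod p)"
  define a where "a = n * mbar"
  define r where "r = ord p a"
  obtain K' N where K': "int (nat \<bar>k\<bar>) = K' * N" and N: "N > 0" and "coprime K' (int p)"
    and copN: "\<And>x. coprime x (int p) \<Longrightarrow> coprime x N"
    using coprime_part_decomposition[of "nat \<bar>k\<bar>" "int p"] \<open>k \<noteq> 0\<close> by auto
  \<comment> \<open>\<open>K\<close> carries the sign of \<open>k\<close>, so that \<open>N\<close>
    stays positive.\<close>
  define K where "K = sgn k * K'"
  have k: "k = K * N"
    unfolding K_def mult.assoc K'[symmetric] by (simp add: sgn_mult_abs)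
  have "coprime K (int p)"
    using \<open>coprime K' (int p)\<close> \<open>k \<noteq> 0\<close> by (auto simp: K_def sgn_if)
  then obtain K1 where K1: "[K * K1 = 1] (mod int p)"
    using cong_solve_coprime_int by blast
  define q where "q = int p * N"
  have q: "q > 0"
    using N \<open>p > 0\<close> by (simp add: q_def)
  define F where "F = (\<lambda>x. f (cis (2 * pi * (of_int x / of_int (int p)))))"
  define G where "G = (\<lambda>x. g (cis (2 * pi * (of_int x / of_int q))))"
  have F_cong: "F x = F y" if "[x = y] (mod int p)" for x y
    using cis_frac_cong[OF _ that] \<open>p > 0\<close> by (simp add: F_def)
  have G_cong: "G x = G y" if "[x = y] (mod q)" for x y
    using cis_frac_cong[OF _ that] q by (simp add: G_def)
  \<comment> \<open>The hypothesis at the \<open>q\<close>-th root of unity with index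
    \<open>x\<close>: its \<open>k\<close>-th power has angle
    \<open>K * N * x / (p * N) = K * x / p\<close>.\<close>
  have FG: "F (K * x) = G (int m * x) - G (int n * x)" for x
  proof -
    define w where "w = cis (2 * pi * (of_int x / of_int q))"
    have "w powi k = cis (2 * pi * (of_int (K * x) / of_int (int p)))"
      using N \<open>p > 0\<close> unfolding w_def cis_power_int
      by (intro arg_cong[of _ _ cis]) (simp add: k q_def field_simps)
    moreover have "w ^ i = cis (2 * pi * (of_int (int i * x) / of_int q))" for i
      unfolding w_def Complex.DeMoivre by (simp add: field_simps)
    ultimately show ?thesis
      using assms(5)[of w] by (simp add: F_def G_def w_def)
  qed
  \<comment> \<open>The indices \<open>b + int p * j\<close> run through the residues modulo
    \<open>q\<close> that reduce to \<open>b\<close> modulo \<open>p\<close>, that is, the fibre of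
    the \<open>N\<close>-th power map over the \<open>p\<close>-th root of unity with index
    \<open>b\<close>.\<close>
  define H where "H = (\<lambda>b. \<Sum>j\<in>{0..<N}. G (b + int p * j))"
  \<comment> \<open>Used with \<open>i = m\<close> and \<open>i = n\<close> to carry one fibre onto
    another, and with \<open>i = 1\<close> and a shift \<open>s\<close> to change the representative
    \<open>b\<close>.\<close>
  have H_affine: "(\<Sum>j\<in>{0..<N}. G (b + int p * (i * j + s))) = H b"
    if "coprime i (int p)" for b i s
    unfolding H_def
  proof (rule sum_periodic_affine[where P = "\<lambda>j. G (b + int p * j)", OF N copN[OF that]])
    fix x y assume "[x = y] (mod N)"
    then have "[int p * x = int p * y] (mod q)"
      by (simp add: q_def cong_def)
    then show "G (b + int p * x) = G (b + int p * y)"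
      by (intro G_cong cong_add) auto
  qed
  have H_cong: "H x = H y" if xy: "[x = y] (mod int p)" for x y
  proof -
    obtain s where s: "x = y + int p * s"
      using xy by (metis cong_iff_lin cong_sym)
    show ?thesis
      using H_affine[of 1 y s] by (simp add: H_def s algebra_simps)
  qed
  have copi: "coprime (int m) (int p)" "coprime (int n) (int p)"
    using cop unfolding coprime_int_iff by (simp_all only: flip: coprime_iff_gcd_eq_1)
  have mbar': "[int m * int mbar = 1] (mod int p)"
    using mbar cong_int_iff[of "m * mbar" 1 p] by simp
  define h where "h = (\<lambda>l. H (int m * K1 * int c * int a ^ l))"
  have fibre: "of_int N * F (int c * int a ^ l) = h l - h (Suc l)" for l
  proof -
    \<comment> \<open>\<open>b\<close> solves \<open>K * b = c * a ^ l\<close> modulo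
      \<open>p\<close>, so \<open>F (K * x)\<close> is constant on the fibre over \<open>b\<close>,
      and summing it gives the factor \<open>N\<close>.\<close>
    define b where "b = K1 * int c * int a ^ l"
    have "[K * (b + int p * j) = int c * int a ^ l] (mod int p)" for j
    proof -
      have "[K * K1 * (int c * int a ^ l) + int p * (K * j) = 1 * (int c * int a ^ l) + 0] (mod int p)"
        by (intro cong_add cong_mult K1) (auto simp: cong_def)
      then show ?thesis
        by (simp add: b_def algebra_simps)
    qed
    then have "F (K * (b + int p * j)) = F (int c * int a ^ l)" for j
      by (rule F_cong)
    then have "of_int N * F (int c * int a ^ l) = (\<Sum>j\<in>{0..<N}. F (K * (b + int p * j)))"
      using N by simp
    also have "\<dots> = H (int m * b) - H (int n * b)"
      using H_affine[OF copi(1), of "int m * b" 0] H_affine[OF copi(2), of "int n * b" 0]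
      unfolding FG sum_subtractf by (simp add: algebra_simps)
    \<comment> \<open>Modulo \<open>p\<close>,
      \<open>n * b = m * (n * mbar) * b = m * a * b\<close>: this raises the exponent of
      \<open>a\<close> by one.\<close>
    also have "H (int n * b) = h (Suc l)"
    proof -
      have "[int m * int mbar * (int n * b) = 1 * (int n * b)] (mod int p)"
        by (intro cong_mult mbar') auto
      then have "H (int n * b) = H (int m * int mbar * (int n * b))"
        by (intro H_cong) (simp add: cong_sym)
      then show ?thesis
        by (simp add: h_def b_def a_def algebra_simps)
    qed
    also have "H (int m * b) = h l"
      by (simp add: h_def b_def algebra_simps)
    finally show ?thesis .
  qed
  \<comment> \<open>The powers of \<open>a\<close> return to their start after \<open>r\<close>
    steps, so the two ends of the telescoping sum cancel.\<close>
  have "[int a ^ r = 1] (mod int p)"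
    using ord[of a p] cong_int_iff[of "a ^ r" 1 p] by (simp add: r_def)
  then have "h (Suc r) = h 1"
    unfolding h_def
    by (intro H_cong) (use cong_scalar_left[of "int a ^ r" 1 "int p" "int m * K1 * int c * int a"]
      in \<open>simp add: mult_ac\<close>)
  moreover have "(\<Sum>l = 1..r. h l - h (Suc l)) = h 1 - h (Suc r)"
    by (induction r) auto
  ultimately have "of_int N * (\<Sum>l = 1..r. F (int c * int a ^ l)) = 0"
    by (simp add: sum_distrib_left fibre)
  then have "(\<Sum>l = 1..r. F (int c * int a ^ l)) = 0"
    using N by simp
  moreover have "exp (2 * pi * \<i> * of_nat (c * a ^ l) / of_nat p)
      = cis (2 * pi * (of_int (int c * int a ^ l) / of_int (int p)))" for l
    by (simp add: cis_conv_exp mult_ac)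
  ultimately show "(\<Sum>l = 1..ord p (n * mbar).
      f (exp (2 * pi * \<i> * of_nat (c * (n * mbar) ^ l) / of_nat p))) = 0"
    by (simp add: F_def a_def r_def)
qed

end
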